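(* Suppose $k$ is a positive integer and $A \in \mathcal{B}(\mathcal{H})$ for an infinite dimensional (complex) Hilbert space $\mathcal{H}$. Then $\Lambda_k(A) \neq \emptyset$.
   Context: $\mathcal{B}(\mathcal{H})$ denotes the algebra of bounded linear operators acting on the infinite dimensional complex Hilbert space $\mathcal{H}$. For $A \in \mathcal{B}(\mathcal{H})$ and a positive integer $k$, the rank-$k$ numerical range of $A$ is $$\Lambda_k(A) = \{\gamma \in \mathbb{C} : X^*AX = \gamma I_k \text{ for some linear map } X : \mathbb{C}^k \to \mathcal{H} \text{ with } X^*X = I_k\},$$ where $X^*$ is the adjoint of $X$ and $I_k$ is the identity operator on $\mathbb{C}^k$. *)

theory Defs
  imports "HOL-Analysis.Analysis" "Jordan_Normal_Form.Conjugate" "Jordan_Normal_Form.Matrix"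
begin

text \<open>
  The real inner product inherited from \<^class>\<open>real_inner\<close> is the real part of the complex one,
  so that \<open>norm x = sqrt (Re (cinner x x))\<close>, and positive definiteness of \<open>cinner\<close> follows
  (lemma \<open>cinner_self\<close>). The complex inner product is linear in its first argument.
\<close>

class complex_inner = real_inner +
  fixes scaleC :: "complex \<Rightarrow> 'a \<Rightarrow> 'a"
    and cinner :: "'a \<Rightarrow> 'a \<Rightarrow> complex"
  assumes scaleC_add_right: "scaleC a (x + y) = scaleC a x + scaleC a y"
    and scaleC_add_left: "scaleC (a + b) x = scaleC a x + scaleC b x"
    and scaleC_scaleC: "scaleC a (scaleC b x) = scaleC (a * b) x"
    and scaleC_one: "scaleC 1 x = x"
    and scaleC_of_real: "scaleC (complex_of_real r) x = scaleR r x"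
    and cinner_commute: "cinner x y = cnj (cinner y x)"
    and cinner_add_left: "cinner (x + y) z = cinner x z + cinner y z"
    and cinner_scaleC_left: "cinner (scaleC a x) y = a * cinner x y"
    and inner_eq_Re_cinner: "inner x y = Re (cinner x y)"

class complex_hilbert_space = complex_inner + complete_space

global_interpretation complex_vector: vector_space "scaleC :: complex \<Rightarrow> 'a \<Rightarrow> 'a :: complex_inner"
  by unfold_locales
    (rule scaleC_add_right scaleC_add_left scaleC_scaleC scaleC_one)+

lemma cinner_self: "cinner x x = complex_of_real ((norm x)\<^sup>2)"
proof -
  have "Im (cinner x x) = 0"
    using arg_cong[OF cinner_commute[of x x], of Im] by simp
  thus ?thesis
    by (simp add: complex_eq_iff power2_norm_eq_inner inner_eq_Re_cinner)
qed

lemma cinner_zero_left: "cinner 0 (y :: 'a :: complex_inner) = 0"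
  using cinner_add_left[of 0 0 y] by simp

lemma cinner_add_right: "cinner x (y + z) = cinner x y + cinner x (z :: 'a :: complex_inner)"
  using cinner_commute[of x] by (metis cinner_add_left complex_cnj_add)

lemma cinner_scaleC_right: "cinner x (scaleC a y) = cnj a * cinner x (y :: 'a :: complex_inner)"
  using cinner_commute[of x] by (metis cinner_scaleC_left complex_cnj_mult)

definition infinite_dimensional :: "'h :: complex_inner itself \<Rightarrow> bool" where
  "infinite_dimensional _ \<longleftrightarrow> (\<nexists>B :: 'h set. finite B \<and> complex_vector.span B = UNIV)"

definition bounded_operator :: "('h :: complex_inner \<Rightarrow> 'h) \<Rightarrow> bool" where
  "bounded_operator A \<longleftrightarrow> Vector_Spaces.linear scaleC scaleC A \<and> bounded_linear A"

text \<open>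
  The space \<open>\<complex>\<^sup>k\<close> is \<^term>\<open>carrier_vec k :: complex vec set\<close> with inner product \<open>v \<bullet>c w\<close>,
  which is also linear in its first argument.
\<close>

definition linear_from_Ck :: "nat \<Rightarrow> (complex vec \<Rightarrow> 'h :: complex_inner) \<Rightarrow> bool" where
  "linear_from_Ck k X \<longleftrightarrow>
     (\<forall>v \<in> carrier_vec k. \<forall>w \<in> carrier_vec k. X (v + w) = X v + X w) \<and>
     (\<forall>a. \<forall>v \<in> carrier_vec k. X (a \<cdot>\<^sub>v v) = scaleC a (X v))"

text \<open>Existence and uniqueness of the adjoint of a linear map are shown below
  (lemmas \<open>adjoint_Ck\<close> and \<open>adjoint_Ck_eqI\<close>).\<close>

definition adjoint_Ck :: "nat \<Rightarrow> (complex vec \<Rightarrow> 'h :: complex_inner) \<Rightarrow> 'h \<Rightarrow> complex vec" where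
  "adjoint_Ck k X h =
     (THE w. w \<in> carrier_vec k \<and> (\<forall>v \<in> carrier_vec k. cinner (X v) h = v \<bullet>c w))"

definition rank_numerical_range ::
    "nat \<Rightarrow> ('h :: complex_inner \<Rightarrow> 'h) \<Rightarrow> complex set" (\<open>\<Lambda>\<^bsub>_\<^esub>\<close>) where
  "\<Lambda>\<^bsub>k\<^esub> A = {\<gamma>. \<exists>X. linear_from_Ck k X \<and>
     (\<forall>v \<in> carrier_vec k. adjoint_Ck k X (X v) = v) \<and>
     (\<forall>v \<in> carrier_vec k. adjoint_Ck k X (A (X v)) = \<gamma> \<cdot>\<^sub>v v)}"

lemma adjoint_unique:
  assumes "w \<in> carrier_vec k" "w' \<in> carrier_vec k"
    and "\<forall>v \<in> carrier_vec k. v \<bullet>c w = v \<bullet>c (w' :: complex vec)"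
  shows "w = w'"
proof (rule eq_vecI)
  fix i assume i: "i < dim_vec w'"
  hence ik: "i < k" using assms by auto
  have "unit_vec k i \<bullet>c w = unit_vec k i \<bullet>c w'"
    using assms by auto
  hence "conjugate w $ i = conjugate w' $ i"
    using ik scalar_prod_left_unit[of "conjugate w" k i] scalar_prod_left_unit[of "conjugate w'" k i]
      assms by simp
  thus "w $ i = w' $ i"
    using assms ik by simp
qed (use assms in auto)

lemma linear_from_Ck_expand:
  assumes X: "linear_from_Ck k X" and v: "v \<in> carrier_vec k"
  shows "cinner (X v) h = (\<Sum>i<k. v $ i * cinner (X (unit_vec k i)) h)"
proof -
  define p where "p n = vec k (\<lambda>i. if i < n then v $ i else 0)" for n
  have add: "X (a + b) = X a + X b" if "a \<in> carrier_vec k" "b \<in> carrier_vec k" for a b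
    using X that by (auto simp: linear_from_Ck_def)
  have scale: "X (c \<cdot>\<^sub>v a) = scaleC c (X a)" if "a \<in> carrier_vec k" for a c
    using X that by (auto simp: linear_from_Ck_def)
  have "cinner (X (p n)) h = (\<Sum>i<n. v $ i * cinner (X (unit_vec k i)) h)" if "n \<le> k" for n
    using that
  proof (induction n)
    case 0
    have "p 0 = 0 \<cdot>\<^sub>v 0\<^sub>v k" by (auto simp: p_def)
    hence "X (p 0) = scaleC 0 (X (0\<^sub>v k))" using scale[of "0\<^sub>v k" 0] by simp
    thus ?case by (simp add: cinner_zero_left)
  next
    case (Suc n)
    have "p (Suc n) = p n + v $ n \<cdot>\<^sub>v unit_vec k n"
      using Suc.prems by (intro eq_vecI) (auto simp: p_def less_Suc_eq unit_vec_def)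
    moreover have "p n \<in> carrier_vec k" by (simp add: p_def)
    ultimately show ?case
      using Suc by (simp add: add scale cinner_add_left cinner_scaleC_left)
  qed
  from this[of k] have "cinner (X (p k)) h = (\<Sum>i<k. v $ i * cinner (X (unit_vec k i)) h)" by simp
  moreover have "p k = v" using v by (intro eq_vecI) (auto simp: p_def)
  ultimately show ?thesis by simp
qed

lemma adjoint_Ck_eqI:
  assumes "w \<in> carrier_vec k" "\<And>v. v \<in> carrier_vec k \<Longrightarrow> cinner (X v) h = v \<bullet>c w"
  shows "adjoint_Ck k X h = w"
  unfolding adjoint_Ck_def
  by (rule the_equality) (use assms in \<open>auto intro: adjoint_unique\<close>)

lemma adjoint_Ck:
  assumes X: "linear_from_Ck k X"
  shows "adjoint_Ck k X h \<in> carrier_vec k"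
    and "v \<in> carrier_vec k \<Longrightarrow> cinner (X v) h = v \<bullet>c adjoint_Ck k X h"
proof -
  define w where "w = vec k (\<lambda>i. cnj (cinner (X (unit_vec k i)) h))"
  have w: "w \<in> carrier_vec k" by (simp add: w_def)
  have w_adj: "cinner (X v) h = v \<bullet>c w" if "v \<in> carrier_vec k" for v
    using linear_from_Ck_expand[OF X that, of h]
    by (simp add: scalar_prod_def w_def lessThan_atLeast0)
  have "adjoint_Ck k X h = w" by (rule adjoint_Ck_eqI[OF w w_adj])
  thus "adjoint_Ck k X h \<in> carrier_vec k"
    and "v \<in> carrier_vec k \<Longrightarrow> cinner (X v) h = v \<bullet>c adjoint_Ck k X h"
    using w w_adj by auto
qed

end

theory Submission
  imports Defs
begin

text \<open>
  The membership \<open>\<gamma> \<in> \<Lambda>\<^bsub>k\<^esub> A\<close> means that there are \<open>k\<close> orthonormal vectors \<open>y q\<close> with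
  \<open>cinner (A (y q)) (y r) = \<gamma>\<close> for \<open>q = r\<close> and \<open>0\<close> otherwise
  (\<open>rank_numerical_rangeI\<close>). In infinite dimension these vectors can be found in two
  independent steps.

  First, \<open>A\<close> has an infinite diagonal compression: there is an orthonormal sequence \<open>u\<close> with
  \<open>cinner (A (u n)) (u m) = 0\<close> whenever \<open>n \<noteq> m\<close>
  (\<open>exists_diagonalizing_orthonormal_sequence\<close>). It is built greedily, since each new vector only
  has to be killed by finitely many linear functionals.

  Second, let \<open>a n = cinner (A (u n)) (u n)\<close>. A combination of the \<open>u n\<close> with coefficients
  \<open>sqrt (t n)\<close>, where the \<open>t n\<close> are convex weights, is a unit vector at which the quadratic form of
  \<open>A\<close> takes the value \<open>\<Sum>n. t n * a n\<close>; and combinations over disjoint sets of indices are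
  orthogonal and have vanishing cross terms. So it suffices to find a point \<open>\<gamma>\<close> that lies in the
  convex hulls of the \<open>a n\<close> over \<open>k\<close> disjoint finite blocks of indices. This is a Tverberg-type
  statement. As infinitely many points are available, blocks may be spent generously, and
  iterating Radon's theorem suffices: each round doubles their number
  (\<open>exists_disjoint_blocks_with_common_hull_point\<close>).
\<close>

section \<open>Vectors annihilated by finitely many functionals\<close>

text \<open>
  Passing to the kernel of one more functional costs at most one dimension, so finitely many
  functionals cannot reduce an infinite-dimensional space to a finite-dimensional one.
\<close>

lemma common_kernel_infinite_dimensional:
  fixes F :: "('h :: complex_inner \<Rightarrow> complex) set"
  assumes inf: "infinite_dimensional TYPE('h)"
    and "finite F"
    and "\<And>f. f \<in> F \<Longrightarrow> Vector_Spaces.linear scaleC (*) f"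
    and "finite B"
  shows "\<not> {x. \<forall>f\<in>F. f x = 0} \<subseteq> complex_vector.span B"
  using assms(2-)
proof (induction F arbitrary: B rule: finite_induct)
  case empty
  then show ?case
    using inf by (auto simp: infinite_dimensional_def)
next
  case (insert f F)
  let ?K = "{x. \<forall>f\<in>F. f x = 0}"
  interpret f: Vector_Spaces.linear scaleC "(*)" f
    using insert.prems by simp
  show ?case
  proof
    assume sub: "{x. \<forall>g\<in>insert f F. g x = 0} \<subseteq> complex_vector.span B"
    show False
    proof (cases "\<forall>x\<in>?K. f x = 0")
      case True
      then have "?K \<subseteq> complex_vector.span B"
        using sub by auto
      then show False
        using insert.IH[of B] insert.prems by auto
    next
      case False
      then obtain v where v: "v \<in> ?K" "f v \<noteq> 0"
        by auto
      have "?K \<subseteq> complex_vector.span (insert v B)"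
      proof
        fix x assume x: "x \<in> ?K"
        \<comment> \<open>Subtracting this multiple of \<open>v\<close> moves \<open>x\<close> into the kernel of \<open>f\<close> without leaving \<open>?K\<close>.\<close>
        let ?c = "f x / f v"
        have "g (x - scaleC ?c v) = 0" if "g \<in> insert f F" for g
        proof -
          interpret g: Vector_Spaces.linear scaleC "(*)" g
            using insert.prems that by simp
          show ?thesis
            using that x v by (auto simp: g.diff g.scale)
        qed
        then have "x - scaleC ?c v \<in> complex_vector.span B"
          using sub by blast
        then show "x \<in> complex_vector.span (insert v B)"
          by (auto simp: complex_vector.span_insert)
      qed
      then show False
        using insert.IH[of "insert v B"] insert.prems by auto
    qed
  qed
qed

lemma linear_cinner_comp:
  assumes "Vector_Spaces.linear scaleC scaleC (A :: 'h :: complex_inner \<Rightarrow> 'h)"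
  shows "Vector_Spaces.linear scaleC (*) (\<lambda>x. cinner (A x) y)"
proof -
  interpret A: Vector_Spaces.linear scaleC scaleC A by fact
  show ?thesis
    by unfold_locales (auto simp: A.add A.scale cinner_add_left cinner_scaleC_left algebra_simps)
qed

lemma linear_ident: "Vector_Spaces.linear scaleC scaleC (\<lambda>x :: 'h :: complex_inner. x)"
  by (rule complex_vector.linear_id[unfolded id_def])

lemma exists_unit_vector_in_common_kernel:
  fixes F :: "('h :: complex_inner \<Rightarrow> complex) set"
  assumes "infinite_dimensional TYPE('h)" "finite F"
    and lin: "\<And>f. f \<in> F \<Longrightarrow> Vector_Spaces.linear scaleC (*) f"
  obtains x where "norm x = 1" "\<And>f. f \<in> F \<Longrightarrow> f x = 0"
proof -
  have "\<not> {x. \<forall>f\<in>F. f x = 0} \<subseteq> complex_vector.span {}"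
    by (rule common_kernel_infinite_dimensional) (use assms in auto)
  then obtain x where x: "\<And>f. f \<in> F \<Longrightarrow> f x = 0" "x \<noteq> 0"
    by auto
  have "f (x /\<^sub>R norm x) = 0" if "f \<in> F" for f
  proof -
    interpret f: Vector_Spaces.linear scaleC "(*)" f
      using lin that .
    show ?thesis
      using x(1)[OF that] f.scale[of "complex_of_real (inverse (norm x))" x]
      by (simp only: scaleC_of_real mult_zero_right)
  qed
  then show ?thesis
    using that[of "x /\<^sub>R norm x"] x(2) by simp
qed

text \<open>
  Given the earlier vectors \<open>u m\<close>, all requirements on the next vector \<open>x\<close> are made linear in \<open>x\<close>:
  the entry \<open>cinner (A (u m)) x\<close> of the compression is conjugate-linear, but it vanishes together
  with its conjugate \<open>cinner x (A (u m))\<close>.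
\<close>

lemma exists_diagonalizing_orthonormal_sequence:
  fixes A :: "'h :: complex_inner \<Rightarrow> 'h"
  assumes inf: "infinite_dimensional TYPE('h)"
    and A: "Vector_Spaces.linear scaleC scaleC A"
  obtains u :: "nat \<Rightarrow> 'h" where "\<And>n. norm (u n) = 1"
    and "\<And>n m. n \<noteq> m \<Longrightarrow> cinner (u n) (u m) = 0"
    and "\<And>n m. n \<noteq> m \<Longrightarrow> cinner (A (u n)) (u m) = 0"
proof -
  let ?P = "\<lambda>(u :: nat \<Rightarrow> 'h) n x. norm x = 1 \<and>
    (\<forall>m<n. cinner x (u m) = 0 \<and> cinner x (A (u m)) = 0 \<and> cinner (A x) (u m) = 0)"
  have "\<exists>u. \<forall>n. ?P u n (u n)"
  proof (rule dependent_wellorder_choice[where P = ?P])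
    fix n and u :: "nat \<Rightarrow> 'h"
    let ?F = "(\<Union>m<n. {\<lambda>x. cinner x (u m), \<lambda>x. cinner x (A (u m)), \<lambda>x. cinner (A x) (u m)})"
    have "Vector_Spaces.linear scaleC (*) f" if "f \<in> ?F" for f
      using that linear_cinner_comp[OF A] linear_cinner_comp[OF linear_ident] by auto
    then obtain x where x: "norm x = 1" "\<And>f. f \<in> ?F \<Longrightarrow> f x = 0"
      using exists_unit_vector_in_common_kernel[OF inf, of ?F] by auto
    have "cinner x (u m) = 0 \<and> cinner x (A (u m)) = 0 \<and> cinner (A x) (u m) = 0" if "m < n" for m
    proof (intro conjI)
      show "cinner x (u m) = 0"
        using that by (intro x(2)[of "\<lambda>x. cinner x (u m)"]) auto
      show "cinner x (A (u m)) = 0"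
        using that by (intro x(2)[of "\<lambda>x. cinner x (A (u m))"]) auto
      show "cinner (A x) (u m) = 0"
        using that by (intro x(2)[of "\<lambda>x. cinner (A x) (u m)"]) auto
    qed
    with x(1) have "?P u n x"
      by blast
    then show "\<exists>x. ?P u n x" ..
  qed auto
  then obtain u :: "nat \<Rightarrow> 'h" where norm: "\<And>n. norm (u n) = 1"
    and below: "\<And>m n. m < n \<Longrightarrow> cinner (u n) (u m) = 0"
      "\<And>m n. m < n \<Longrightarrow> cinner (u n) (A (u m)) = 0"
      "\<And>m n. m < n \<Longrightarrow> cinner (A (u n)) (u m) = 0"
    by blast
  have "cinner (u n) (u m) = 0 \<and> cinner (A (u n)) (u m) = 0" if "n \<noteq> m" for n m
  proof (cases "m < n")
    case True
    then show ?thesis using below by simp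
  next
    case False
    then have "n < m" using that by simp
    then show ?thesis
      using below cinner_commute[of "u n" "u m"] cinner_commute[of "A (u n)" "u m"] by simp
  qed
  then show ?thesis
    using that norm by blast
qed

section \<open>Disjoint index blocks with a common point in their convex hulls\<close>

text \<open>
  Radon's theorem for a family instead of a set: a repeated value provides the two disjoint index
  sets at once, and otherwise any \<open>DIM('a) + 2\<close> of the points are affinely dependent.
\<close>

lemma Radon_indexed:
  fixes p :: "nat \<Rightarrow> 'a :: euclidean_space"
  obtains I J where "finite I" "finite J" "I \<inter> J = {}"
    and "convex hull (p ` I) \<inter> convex hull (p ` J) \<noteq> {}"
proof (cases "inj_on p {..<DIM('a) + 2}")
  case True
  let ?N = "{..<DIM('a) + 2}"
  have "affine_dependent (p ` ?N)"
    by (rule affine_dependent_biggerset) (use True in \<open>auto simp: card_image\<close>)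
  then obtain M Q where MQ: "M \<subseteq> p ` ?N" "Q \<subseteq> p ` ?N" "M \<inter> Q = {}"
      "convex hull M \<inter> convex hull Q \<noteq> {}"
    using Radon by blast
  let ?I = "{i\<in>?N. p i \<in> M}" and ?J = "{i\<in>?N. p i \<in> Q}"
  have "p ` ?I = M" "p ` ?J = Q"
    using MQ by auto
  moreover have "?I \<inter> ?J = {}"
    using MQ by auto
  ultimately show ?thesis
    using that[of ?I ?J] MQ by auto
next
  case False
  then obtain i j where "i \<noteq> j" "p i = p j"
    by (auto simp: inj_on_def)
  then show ?thesis
    using that[of "{i}" "{j}"] by auto
qed

lemma convex_hull_Union_blocks:
  assumes x: "x \<in> convex hull (p ` I)"
    and blocks: "\<And>i. i \<in> I \<Longrightarrow> p i \<in> convex hull (a ` T i)"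
  shows "x \<in> convex hull (a ` (\<Union>i\<in>I. T i))"
proof -
  have "convex hull (a ` T i) \<subseteq> convex hull (a ` (\<Union>i\<in>I. T i))" if "i \<in> I" for i
    using that by (intro hull_mono) auto
  then have "convex hull (p ` I) \<subseteq> convex hull (a ` (\<Union>i\<in>I. T i))"
    using blocks by (intro hull_minimal) auto
  then show ?thesis
    using x by auto
qed

text \<open>
  A weak form of Tverberg's theorem, by induction on \<open>j\<close>. Split the sequence into infinitely many
  subsequences. The induction hypothesis gives in the \<open>i\<close>-th one a point \<open>p i\<close> common to the hulls of
  \<open>2 ^ j\<close> blocks. By Radon's theorem some \<open>x\<close> lies in the hulls of \<open>p ` I\<close> and of \<open>p ` J\<close> with \<open>I\<close> and
  \<open>J\<close> disjoint. Merging the \<open>q\<close>-th blocks over all \<open>i \<in> I\<close> gives a block whose hull contains all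
  these \<open>p i\<close>, hence \<open>x\<close>; letting \<open>q\<close> vary and using \<open>J\<close> as well yields twice \<open>2 ^ j\<close> blocks.
\<close>

lemma exists_disjoint_blocks_with_common_hull_point:
  fixes a :: "nat \<Rightarrow> 'a :: euclidean_space"
  shows "\<exists>x (S :: nat \<Rightarrow> nat set). disjoint_family_on S {..<2 ^ j} \<and>
    (\<forall>q<2 ^ j. finite (S q) \<and> x \<in> convex hull (a ` S q))"
proof (induction j arbitrary: a)
  case 0
  show ?case
    by (rule exI[of _ "a 0"], rule exI[of _ "\<lambda>_. {0}"]) (auto simp: disjoint_family_on_def)
next
  case (Suc j)
  have "\<forall>i. \<exists>x (S :: nat \<Rightarrow> nat set). disjoint_family_on S {..<2 ^ j} \<and>
      (\<forall>q<2 ^ j. finite (S q) \<and> x \<in> convex hull ((\<lambda>n. a (prod_encode (i, n))) ` S q))"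
    using Suc.IH by blast
  then obtain p and S :: "nat \<Rightarrow> nat \<Rightarrow> nat set"
    where disj: "\<And>i. disjoint_family_on (S i) {..<2 ^ j}"
    and fin: "\<And>i q. q < 2 ^ j \<Longrightarrow> finite (S i q)"
    and hull: "\<And>i q. q < 2 ^ j \<Longrightarrow> p i \<in> convex hull ((\<lambda>n. a (prod_encode (i, n))) ` S i q)"
    by metis
  obtain I J where IJ: "finite I" "finite J" "I \<inter> J = {}"
    and "convex hull (p ` I) \<inter> convex hull (p ` J) \<noteq> {}"
    using Radon_indexed .
  then obtain x where x: "x \<in> convex hull (p ` I)" "x \<in> convex hull (p ` J)"
    by auto
  \<comment> \<open>The \<open>q\<close>-th blocks merged over the subsequences in \<open>H\<close>, in the indices of the original sequence.\<close>
  define T where "T H q = (\<Union>i\<in>H. (\<lambda>n. prod_encode (i, n)) ` S i q)" for H q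
  have T: "finite (T H q) \<and> x \<in> convex hull (a ` T H q)"
    if "finite H" "x \<in> convex hull (p ` H)" "q < 2 ^ j" for H q
  proof
    show "finite (T H q)"
      using that fin by (simp add: T_def)
    show "x \<in> convex hull (a ` T H q)"
      unfolding T_def
    proof (rule convex_hull_Union_blocks)
      show "p i \<in> convex hull (a ` (\<lambda>n. prod_encode (i, n)) ` S i q)" for i
        using hull[OF that(3)] by (simp add: image_image)
    qed fact
  qed
  have T_disj: "T H q \<inter> T H' q' = {}"
    if "H \<inter> H' = {} \<or> q \<noteq> q'" "q < 2 ^ j" "q' < 2 ^ j" for H H' q q'
  proof -
    have "q = q'" if "n \<in> S i q" "n \<in> S i q'" for i n
      using disj[of i] that \<open>q < 2 ^ j\<close> \<open>q' < 2 ^ j\<close>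
      unfolding disjoint_family_on_def by blast
    then show ?thesis
      using that(1) unfolding T_def by auto
  qed
  define R where "R q = (if q < 2 ^ j then T I q else T J (q - 2 ^ j))" for q
  have "finite (R q) \<and> x \<in> convex hull (a ` R q)" if "q < 2 ^ Suc j" for q
    using that T[of I q] T[of J "q - 2 ^ j"] x IJ by (auto simp: R_def)
  moreover have "disjoint_family_on R {..<2 ^ Suc j}"
    unfolding disjoint_family_on_def
  proof (intro ballI impI)
    fix q r :: nat assume qr: "q \<in> {..<2 ^ Suc j}" "r \<in> {..<2 ^ Suc j}" "q \<noteq> r"
    consider "q < 2 ^ j" "r < 2 ^ j" | "q < 2 ^ j" "2 ^ j \<le> r"
      | "2 ^ j \<le> q" "r < 2 ^ j" | "2 ^ j \<le> q" "2 ^ j \<le> r"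
      by linarith
    then show "R q \<inter> R r = {}"
    proof cases
      case 1
      then show ?thesis
        using qr T_disj[of I I q r] by (simp add: R_def)
    next
      case 2
      then show ?thesis
        using qr IJ T_disj[of I J q "r - 2 ^ j"] by (simp add: R_def)
    next
      case 3
      then show ?thesis
        using qr IJ T_disj[of J I "q - 2 ^ j" r] by (simp add: R_def Int_commute)
    next
      case 4
      then have "q - 2 ^ j \<noteq> r - 2 ^ j"
        using qr by simp
      with 4 show ?thesis
        using qr T_disj[of J J "q - 2 ^ j" "r - 2 ^ j"] by (simp add: R_def)
    qed
  qed
  ultimately show ?case
    by blast
qed

text \<open>
  Here the weights are indexed by \<open>S\<close>, although \<open>a\<close> may repeat values: the whole weight of a point
  is put on one chosen preimage.
\<close>

lemma convex_hull_image_weights: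
  assumes "finite S" "x \<in> convex hull (a ` S)"
  obtains t :: "'b \<Rightarrow> real" where "\<And>n. n \<in> S \<Longrightarrow> 0 \<le> t n" "sum t S = 1"
    and "(\<Sum>n\<in>S. t n *\<^sub>R a n) = x"
proof -
  obtain S' where S': "S' \<subseteq> S" "inj_on a S'" "a ` S = a ` S'"
    using subset_image_inj[of "a ` S" a S] by auto
  have fin: "finite S'"
    using S' assms finite_subset by blast
  obtain w where w: "\<And>y. y \<in> a ` S' \<Longrightarrow> 0 \<le> w y" "sum w (a ` S') = 1"
      "(\<Sum>y\<in>a ` S'. w y *\<^sub>R y) = x"
    using assms S' fin by (auto simp: convex_hull_finite)
  let ?t = "\<lambda>n. if n \<in> S' then w (a n) else 0"
  have "sum ?t S = sum (w \<circ> a) S'"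
    using S' assms by (intro sum.mono_neutral_cong_right) auto
  moreover have "(\<Sum>n\<in>S. ?t n *\<^sub>R a n) = (\<Sum>n\<in>S'. w (a n) *\<^sub>R a n)"
    using S' assms by (intro sum.mono_neutral_cong_right) auto
  ultimately show ?thesis
    using that[of ?t] w S' by (simp add: sum.reindex)
qed

section \<open>Compressions to spans of orthonormal vectors\<close>

lemma cinner_sum_left: "cinner (\<Sum>i\<in>S. f i) y = (\<Sum>i\<in>S. cinner (f i) y)"
  by (induction S rule: infinite_finite_induct) (auto simp: cinner_add_left cinner_zero_left)

lemma cinner_sum_right: "cinner y (\<Sum>i\<in>S. f i) = (\<Sum>i\<in>S. cinner y (f i))"
  by (subst cinner_commute) (simp add: cinner_sum_left cinner_commute[of y])

text \<open>
  The single computation behind all inner products below: with \<open>A\<close> the identity it gives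
  orthonormality, and disjoint index sets \<open>S\<close> and \<open>T\<close> give \<open>0\<close>.
\<close>

lemma cinner_linear_diagonal_sums:
  fixes A :: "'h :: complex_inner \<Rightarrow> 'h"
  assumes A: "Vector_Spaces.linear scaleC scaleC A" and fin: "finite S" "finite T"
    and diag: "\<And>n m. n \<in> S \<Longrightarrow> m \<in> T \<Longrightarrow> n \<noteq> m \<Longrightarrow> cinner (A (u n)) (u m) = 0"
  shows "cinner (A (\<Sum>n\<in>S. scaleC (c n) (u n))) (\<Sum>m\<in>T. scaleC (d m) (u m)) =
    (\<Sum>n\<in>S \<inter> T. c n * cnj (d n) * cinner (A (u n)) (u n))"
proof -
  interpret A: Vector_Spaces.linear scaleC scaleC A by fact
  have inner: "(\<Sum>m\<in>T. c n * cnj (d m) * cinner (A (u n)) (u m)) =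
      (if n \<in> T then c n * cnj (d n) * cinner (A (u n)) (u n) else 0)" if "n \<in> S" for n
  proof -
    have "(\<Sum>m\<in>T. c n * cnj (d m) * cinner (A (u n)) (u m)) =
        (\<Sum>m\<in>T. if m = n then c n * cnj (d n) * cinner (A (u n)) (u n) else 0)"
      using that diag by (intro sum.cong) auto
    then show ?thesis
      using fin by (simp add: sum.delta)
  qed
  have "cinner (A (\<Sum>n\<in>S. scaleC (c n) (u n))) (\<Sum>m\<in>T. scaleC (d m) (u m)) =
      (\<Sum>n\<in>S. \<Sum>m\<in>T. c n * cnj (d m) * cinner (A (u n)) (u m))"
    unfolding A.sum cinner_sum_left A.scale cinner_scaleC_left
    by (simp add: cinner_sum_right cinner_scaleC_right sum_distrib_left mult.assoc)
  also have "\<dots> = (\<Sum>n\<in>S. if n \<in> T then c n * cnj (d n) * cinner (A (u n)) (u n) else 0)"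
    using inner by (rule sum.cong[OF refl])
  finally show ?thesis
    using fin by (simp add: sum.inter_restrict)
qed

lemma rank_numerical_rangeI:
  fixes A :: "'h :: complex_inner \<Rightarrow> 'h"
  assumes A: "Vector_Spaces.linear scaleC scaleC A"
    and orth: "\<And>q r. q < k \<Longrightarrow> r < k \<Longrightarrow> cinner (y q) (y r) = (if q = r then 1 else 0)"
    and diag: "\<And>q r. q < k \<Longrightarrow> r < k \<Longrightarrow> cinner (A (y q)) (y r) = (if q = r then \<gamma> else 0)"
  shows "\<gamma> \<in> \<Lambda>\<^bsub>k\<^esub> A"
proof -
  \<comment> \<open>The isometry that sends the standard basis to the vectors \<open>y q\<close>.\<close>
  define X where "X v = (\<Sum>q<k. scaleC (v $ q) (y q))" for v :: "complex vec"
  have lin: "linear_from_Ck k X"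
    by (auto simp: linear_from_Ck_def X_def scaleC_add_left sum.distrib
        complex_vector.scale_sum_right)
  have XX: "cinner (X v) (X w) = v \<bullet>c w" if "w \<in> carrier_vec k" for v w
    using that cinner_linear_diagonal_sums[OF linear_ident, of "{..<k}" "{..<k}" y] orth
    by (simp add: X_def scalar_prod_def lessThan_atLeast0)
  have AX: "cinner (A (X v)) (X w) = \<gamma> * (v \<bullet>c w)" if "w \<in> carrier_vec k" for v w
    using that cinner_linear_diagonal_sums[OF A, of "{..<k}" "{..<k}" y] diag
    by (simp add: X_def scalar_prod_def lessThan_atLeast0 sum_distrib_left mult_ac)
  have swap: "cnj (v \<bullet>c w) = w \<bullet>c v" if "v \<in> carrier_vec k" "w \<in> carrier_vec k"
    for v w :: "complex vec"
    using that by (simp add: scalar_prod_def mult.commute)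
  have "adjoint_Ck k X (X v) = v" if "v \<in> carrier_vec k" for v
    using that by (intro adjoint_Ck_eqI) (auto simp: XX)
  moreover have "adjoint_Ck k X (A (X v)) = \<gamma> \<cdot>\<^sub>v v" if v: "v \<in> carrier_vec k" for v
  proof (rule adjoint_Ck_eqI)
    fix w :: "complex vec" assume w: "w \<in> carrier_vec k"
    have "cinner (X w) (A (X v)) = cnj (\<gamma> * (v \<bullet>c w))"
      using AX[OF w] cinner_commute by metis
    also have "\<dots> = w \<bullet>c (\<gamma> \<cdot>\<^sub>v v)"
      using v w swap[OF v w] by (simp add: conjugate_smult_vec)
    finally show "cinner (X w) (A (X v)) = w \<bullet>c (\<gamma> \<cdot>\<^sub>v v)" .
  qed (use v in simp)
  ultimately show ?thesis
    using lin by (auto simp: rank_numerical_range_def)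
qed

theorem corollary4:
  fixes k :: nat and A :: "'h :: complex_hilbert_space \<Rightarrow> 'h"
  assumes "k > 0"
    and "infinite_dimensional TYPE('h)"
    and "bounded_operator A"
  shows "\<Lambda>\<^bsub>k\<^esub> A \<noteq> {}"
proof -
  have A: "Vector_Spaces.linear scaleC scaleC A"
    using assms(3) by (simp add: bounded_operator_def)
  obtain u :: "nat \<Rightarrow> 'h" where norm: "\<And>n. norm (u n) = 1"
    and orth: "\<And>n m. n \<noteq> m \<Longrightarrow> cinner (u n) (u m) = 0"
    and diag: "\<And>n m. n \<noteq> m \<Longrightarrow> cinner (A (u n)) (u m) = 0"
    using exists_diagonalizing_orthonormal_sequence[OF assms(2) A] by blast
  define a where "a n = cinner (A (u n)) (u n)" for n
  obtain \<gamma> and S :: "nat \<Rightarrow> nat set" where disj: "disjoint_family_on S {..<2 ^ k}"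
    and fin: "\<And>q. q < 2 ^ k \<Longrightarrow> finite (S q)"
    and hull: "\<And>q. q < 2 ^ k \<Longrightarrow> \<gamma> \<in> convex hull (a ` S q)"
    using exists_disjoint_blocks_with_common_hull_point[of k a] by blast
  have "\<exists>t :: nat \<Rightarrow> real. (\<forall>n\<in>S q. 0 \<le> t n) \<and> sum t (S q) = 1 \<and> (\<Sum>n\<in>S q. t n *\<^sub>R a n) = \<gamma>"
    if "q \<in> {..<2 ^ k}" for q
  proof -
    have "finite (S q)" "\<gamma> \<in> convex hull (a ` S q)"
      using that fin hull by auto
    then show ?thesis
      by (rule convex_hull_image_weights) blast
  qed
  then have "\<exists>t. \<forall>q\<in>{..<2 ^ k}. (\<forall>n\<in>S q. 0 \<le> t q n) \<and> sum (t q) (S q) = (1 :: real) \<and>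
      (\<Sum>n\<in>S q. t q n *\<^sub>R a n) = \<gamma>"
    by (intro bchoice ballI)
  then obtain t :: "nat \<Rightarrow> nat \<Rightarrow> real" where t: "\<And>q n. q < 2 ^ k \<Longrightarrow> n \<in> S q \<Longrightarrow> 0 \<le> t q n"
      "\<And>q. q < 2 ^ k \<Longrightarrow> sum (t q) (S q) = 1"
      "\<And>q. q < 2 ^ k \<Longrightarrow> (\<Sum>n\<in>S q. t q n *\<^sub>R a n) = \<gamma>"
    by blast
  \<comment> \<open>Square roots, so that the squared moduli of the coefficients are the convex weights.\<close>
  define c where "c q n = complex_of_real (sqrt (t q n))" for q n
  define y where "y q = (\<Sum>n\<in>S q. scaleC (c q n) (u n))" for q
  have c: "c q n * cnj (c q n) = of_real (t q n)" if "q < 2 ^ k" "n \<in> S q" for q n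
    using t(1)[OF that] by (simp add: c_def flip: of_real_mult)
  \<comment> \<open>Of the \<open>2 ^ k\<close> blocks only the first \<open>k\<close> are used from here on.\<close>
  have k: "q < 2 ^ k" if "q < k" for q
    using that less_exp[of k] by (rule less_trans)
  have S_Int: "S q \<inter> S r = (if q = r then S q else {})" if "q < k" "r < k" for q r
    using disj k that by (auto simp: disjoint_family_on_def)
  have "cinner (y q) (y r) = (if q = r then 1 else 0)" if "q < k" "r < k" for q r
  proof -
    have "cinner (y q) (y r) = (\<Sum>n\<in>S q \<inter> S r. c q n * cnj (c r n) * cinner (u n) (u n))"
      unfolding y_def using fin k that orth
      by (intro cinner_linear_diagonal_sums[OF linear_ident]) auto
    also have "\<dots> = (if q = r then \<Sum>n\<in>S q. complex_of_real (t q n) else 0)"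
      using that k c by (simp add: S_Int cinner_self norm)
    also have "\<dots> = (if q = r then 1 else 0)"
      using t(2) k that by (simp flip: of_real_sum)
    finally show ?thesis .
  qed
  moreover have "cinner (A (y q)) (y r) = (if q = r then \<gamma> else 0)" if "q < k" "r < k" for q r
  proof -
    have "cinner (A (y q)) (y r) = (\<Sum>n\<in>S q \<inter> S r. c q n * cnj (c r n) * a n)"
      unfolding y_def a_def using fin k that diag
      by (intro cinner_linear_diagonal_sums[OF A]) auto
    also have "\<dots> = (if q = r then \<Sum>n\<in>S q. t q n *\<^sub>R a n else 0)"
      using that k c by (simp add: S_Int scaleR_conv_of_real)
    also have "\<dots> = (if q = r then \<gamma> else 0)"
      using t(3) k that by simp
    finally show ?thesis .
  qed
  ultimately have "\<gamma> \<in> \<Lambda>\<^bsub>k\<^esub> A"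
    by (rule rank_numerical_rangeI[OF A])
  then show ?thesis
    by blast
qed

end
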